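(* Let $N\ge 1$ and let $(h_\alpha,\vec u_{H,\alpha})_{\alpha=1,\dots,N}$, with $h_\alpha=h_\alpha(t,x)>0$ and $\vec u_{H,\alpha}=\vec u_{H,\alpha}(t,x)\in\mathbb{R}^2$, be a smooth solution of the $\mu(I)$ multilayer shallow system $$\partial_t h_\alpha+\nabla_x\cdot(h_\alpha \vec u_{H,\alpha})=G_{\alpha+\frac12}-G_{\alpha-\frac12},$$ $$\rho\,\partial_t(h_\alpha\vec u_{H,\alpha})+\nabla_x\cdot(\rho h_\alpha\vec u_{H,\alpha}\otimes\vec u_{H,\alpha})+h_\alpha\nabla_x p_S+\rho g h_\alpha\nabla_x(z_b+h)=\vec K_{\alpha-\frac12}-\vec K_{\alpha+\frac12}+\tfrac12\rho G_{\alpha+\frac12}(\vec u_{H,\alpha+1}+\vec u_{H,\alpha})-\tfrac12\rho G_{\alpha-\frac12}(\vec u_{H,\alpha}+\vec u_{H,\alpha-1}),$$ for $\alpha=1,\dots,N$, where $h=\sum_{\alpha=1}^N h_\alpha$, where $\vec u_{H,0}=\vec u_{H,N+1}=0$ and $G_{N+\frac12}=0$, and where the mass fluxes $G_{\alpha+\frac12}$, the stress terms $\vec K_{\alpha+\frac12}$ and the viscosities $\eta_{\alpha+\frac12}$ are those defined in the context. For $\alpha=1,\dots,N$ denote the energy of layer $\alpha$ by $$E_\alpha=h_\alpha\left(\frac{|\vec u_{H,\alpha}|^2}{2}+\frac{p_S}{\rho}+g\Big(z_b+\frac h2\Big)\right).$$ Then the following dissipative energy inequality is satisfied: $$\rho\,\partial_t\Big(\sum_{\alpha=1}^N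 E_\alpha\Big)+\rho\,\nabla_x\cdot\Big[\sum_{\alpha=1}^N\vec u_{H,\alpha}\Big(E_\alpha+g h_\alpha\frac h2\Big)\Big]\le h\,\partial_t(p_S+\rho g z_b)-\rho g h|\vec u_{H,1}|\,\mu(I)-\frac{|\vec u_{H,N}|^2}{h_N}\eta_{N+\frac12}-\sum_{\alpha=1}^{N-1}\frac{|\vec u_{H,\alpha+1}-\vec u_{H,\alpha}|^2}{h_{\alpha+\frac12}}\eta_{\alpha+\frac12}-G_{\frac12}\big(p_S+\rho g(z_b+h)\big).$$
   Context: All functions depend on time $t$ and the horizontal variable $x=(x_1,x_2)$ in an open set, and are smooth; $\nabla_x=(\partial_{x_1},\partial_{x_2})$. The constants are the density $\rho>0$, gravity $g>0$, the particle diameter $d_s>0$, the particle density $\rho_s>0$, $I_0>0$ and $\mu_2>\mu_s>0$. The given functions are the bottom elevation $z_b(t,x)$, the surface pressure $p_S(t,x)\ge 0$ and the mass exchange with the bottom $G_{\frac12}(t,x)$. Layers: $h_\alpha>0$ is the thickness of layer $\alpha$; the interfaces are $z_{\frac12}=z_b$ and $z_{\alpha+\frac12}=z_b+\sum_{\beta=1}^{\alpha}h_\beta$. The number $h_{\alpha+\frac12}=\frac12(h_\alpha+h_{\alpha+1})$, $1\le\alpha\le N-1$, is the distance between the midpoints of layers $\alpha$ and $\alpha+1$. Mass fluxes: for $1\le\alpha\le N-1$, $$G_{\alpha+\frac12}=\partial_t z_{\alpha+\frac12}+\vec u_{H,\alpha+1}\cdot\nabla_x z_{\alpha+\frac12}-w^+_{\alpha+\frac12}=\partial_t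 z_{\alpha+\frac12}+\vec u_{H,\alpha}\cdot\nabla_x z_{\alpha+\frac12}-w^-_{\alpha+\frac12},$$ the first expression being used for $\alpha=0$ and the second for $\alpha=N$. The vertical velocities at the interfaces are determined by $w^+_{\frac12}=\vec u_{H,1}\cdot\nabla_x z_b+\partial_t z_b-G_{\frac12}$, $w^-_{\alpha+\frac12}=w^+_{\alpha-\frac12}-h_\alpha\nabla_x\cdot\vec u_{H,\alpha}$ and $w^+_{\alpha+\frac12}=(\vec u_{H,\alpha+1}-\vec u_{H,\alpha})\cdot\nabla_x z_{\alpha+\frac12}+w^-_{\alpha+\frac12}$. There is no mass transfer with the atmosphere: $G_{N+\frac12}=0$. The velocities of the bottom and of the atmosphere are $\vec u_{H,0}=\vec u_{H,N+1}=0$. Rheology: $\mu(I)=\mu_s+\dfrac{\mu_2-\mu_s}{I_0+I}\,I$ for $I\ge0$. For $1\le\alpha\le N$, $\vec K_{\alpha+\frac12}=-\eta_{\alpha+\frac12}\vec Q_{H,\alpha+\frac12}$, with $$\vec Q_{H,\alpha+\frac12}=\frac{\vec u_{H,\alpha+1}-\vec u_{H,\alpha}}{h_{\alpha+\frac12}}\ (1\le\alpha\le N-1),\qquad \vec Q_{H,N+\frac12}=\frac{\vec u_{H,N+1}-\vec u_{H,N}}{h_N},$$ $$\eta_{\alpha+\frac12}=\frac{\mu(I_{\alpha+\frac12})\,p_{\alpha+\frac12}}{\max\left(|\vec Q_{H,\alpha+\frac12}|,\ \mu(I_{\alpha+\frac12})\,p_{\alpha+\frac12}/\eta_M\right)},\quad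 p_{\alpha+\frac12}=p_S+\rho g\sum_{\beta=\alpha+1}^N h_\beta,\quad I_{\alpha+\frac12}=\frac{d_s|\vec Q_{H,\alpha+\frac12}|}{\sqrt{p_{\alpha+\frac12}/\rho_s}},$$ where $\eta_M=250\,\rho\sqrt{g h^3}$. (If $p_{\alpha+\frac12}=0$, the product $\mu(I_{\alpha+\frac12})p_{\alpha+\frac12}$ is read as $0$; if moreover $\vec Q_{H,\alpha+\frac12}=0$, $\eta_{\alpha+\frac12}$ is any value in $[0,\eta_M]$.) At the bottom, $$\vec K_{\frac12}=-\mu(I)\,\rho g h\,\frac{\vec u_{H,1}}{|\vec u_{H,1}|},$$ where $I=I(t,x)\ge0$ is the value of the inertial number at the bottom, and this same $\mu(I)$ appears in the energy inequality. Where $\vec u_{H,1}=0$, $\vec u_{H,1}/|\vec u_{H,1}|$ is read as an arbitrary fixed vector of norm at most $1$. *)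

theory Defs
  imports "HOL-Analysis.Analysis"
begin

text \<open>
  Fields depend on a point \<open>p = (t, x)\<close> with \<open>t\<close> the time and \<open>x\<close> the horizontal position.
  Layers carry the indices \<open>1, \<dots>, N\<close>; the interface \<open>\<alpha> + 1/2\<close> is given the index \<open>\<alpha>\<close>,
  so that \<open>0\<close> is the bottom and \<open>N\<close> is the free surface.
\<close>

type_synonym point = "real \<times> (real ^ 2)"


subsection \<open>Smoothness and partial derivatives\<close>

primrec Ck_on :: "nat \<Rightarrow> 'a::real_normed_vector set \<Rightarrow> ('a \<Rightarrow> 'b::real_normed_vector) \<Rightarrow> bool" where
  "Ck_on 0 S f \<longleftrightarrow> continuous_on S f"
| "Ck_on (Suc k) S f \<longleftrightarrow>
     (\<forall>x\<in>S. f differentiable (at x)) \<and> (\<forall>v. Ck_on k S (\<lambda>x. frechet_derivative f (at x) v))"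

text \<open>Meant for open \<open>S\<close> only.\<close>

definition smooth_on :: "'a::real_normed_vector set \<Rightarrow> ('a \<Rightarrow> 'b::real_normed_vector) \<Rightarrow> bool" where
  "smooth_on S f \<longleftrightarrow> (\<forall>k. Ck_on k S f)"

definition dt :: "(point \<Rightarrow> 'a::real_normed_vector) \<Rightarrow> point \<Rightarrow> 'a" where
  "dt f p = vector_derivative (\<lambda>s. f (s, snd p)) (at (fst p))"

definition dx :: "2 \<Rightarrow> (point \<Rightarrow> 'a::real_normed_vector) \<Rightarrow> point \<Rightarrow> 'a" where
  "dx j f p = vector_derivative (\<lambda>s. f (fst p, snd p + s *\<^sub>R axis j 1)) (at 0)"

definition grad :: "(point \<Rightarrow> real) \<Rightarrow> point \<Rightarrow> real ^ 2" where
  "grad f p = (\<chi> j. dx j f p)"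

definition divg :: "(point \<Rightarrow> real ^ 2) \<Rightarrow> point \<Rightarrow> real" where
  "divg F p = (\<Sum>j\<in>UNIV. dx j (\<lambda>q. F q $ j) p)"

definition outer :: "real ^ 2 \<Rightarrow> real ^ 2 \<Rightarrow> real ^ 2 ^ 2" where
  "outer a b = (\<chi> i j. a $ i * b $ j)"

definition div_tensor :: "(point \<Rightarrow> real ^ 2 ^ 2) \<Rightarrow> point \<Rightarrow> real ^ 2" where
  "div_tensor A p = (\<chi> i. divg (\<lambda>q. A q $ i) p)"


subsection \<open>Geometry of the layers\<close>

definition total_height :: "nat \<Rightarrow> (nat \<Rightarrow> point \<Rightarrow> real) \<Rightarrow> point \<Rightarrow> real" where
  "total_height N h p = (\<Sum>\<alpha>=1..N. h \<alpha> p)"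

definition interface ::
  "(point \<Rightarrow> real) \<Rightarrow> (nat \<Rightarrow> point \<Rightarrow> real) \<Rightarrow> nat \<Rightarrow> point \<Rightarrow> real" where
  "interface zb h \<alpha> p = zb p + (\<Sum>\<beta>=1..\<alpha>. h \<beta> p)"

definition mid_dist :: "(nat \<Rightarrow> point \<Rightarrow> real) \<Rightarrow> nat \<Rightarrow> point \<Rightarrow> real" where
  "mid_dist h \<alpha> p = (h \<alpha> p + h (\<alpha> + 1) p) / 2"


subsection \<open>Vertical velocities and mass fluxes at the interfaces\<close>

text \<open>\<open>Gb\<close> is the given mass exchange with the bottom.\<close>

primrec w_plus ::
  "(point \<Rightarrow> real) \<Rightarrow> (point \<Rightarrow> real) \<Rightarrow> (nat \<Rightarrow> point \<Rightarrow> real) \<Rightarrow> (nat \<Rightarrow> point \<Rightarrow> real ^ 2)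
   \<Rightarrow> nat \<Rightarrow> point \<Rightarrow> real" where
  "w_plus zb Gb h u 0 = (\<lambda>p. u 1 p \<bullet> grad zb p + dt zb p - Gb p)"
| "w_plus zb Gb h u (Suc \<alpha>) = (\<lambda>p.
     (u (Suc \<alpha> + 1) p - u (Suc \<alpha>) p) \<bullet> grad (interface zb h (Suc \<alpha>)) p
     + (w_plus zb Gb h u \<alpha> p - h (Suc \<alpha>) p * divg (u (Suc \<alpha>)) p))"

definition w_minus ::
  "(point \<Rightarrow> real) \<Rightarrow> (point \<Rightarrow> real) \<Rightarrow> (nat \<Rightarrow> point \<Rightarrow> real) \<Rightarrow> (nat \<Rightarrow> point \<Rightarrow> real ^ 2)
   \<Rightarrow> nat \<Rightarrow> point \<Rightarrow> real" where
  "w_minus zb Gb h u \<alpha> p = w_plus zb Gb h u (\<alpha> - 1) p - h \<alpha> p * divg (u \<alpha>) p"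

lemma w_plus_eq_w_minus:
  assumes "\<alpha> \<ge> 1"
  shows "w_plus zb Gb h u \<alpha> p =
    (u (\<alpha> + 1) p - u \<alpha> p) \<bullet> grad (interface zb h \<alpha>) p + w_minus zb Gb h u \<alpha> p"
  using assms by (cases \<alpha>) (simp_all add: w_minus_def)

text \<open>
  Only the expression with \<open>w_plus\<close> makes sense at the bottom and only the one with \<open>w_minus\<close> at
  the free surface; at inner interfaces the two agree.
\<close>

definition mass_flux ::
  "nat \<Rightarrow> (point \<Rightarrow> real) \<Rightarrow> (point \<Rightarrow> real) \<Rightarrow> (nat \<Rightarrow> point \<Rightarrow> real)
   \<Rightarrow> (nat \<Rightarrow> point \<Rightarrow> real ^ 2) \<Rightarrow> nat \<Rightarrow> point \<Rightarrow> real" where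
  "mass_flux N zb Gb h u \<alpha> p =
     (if \<alpha> < N
      then dt (interface zb h \<alpha>) p + u (\<alpha> + 1) p \<bullet> grad (interface zb h \<alpha>) p - w_plus zb Gb h u \<alpha> p
      else dt (interface zb h \<alpha>) p + u \<alpha> p \<bullet> grad (interface zb h \<alpha>) p - w_minus zb Gb h u \<alpha> p)"

lemma mass_flux_inner:
  assumes "1 \<le> \<alpha>" "\<alpha> < N"
  shows "mass_flux N zb Gb h u \<alpha> p =
    dt (interface zb h \<alpha>) p + u \<alpha> p \<bullet> grad (interface zb h \<alpha>) p - w_minus zb Gb h u \<alpha> p"
  using assms by (simp add: mass_flux_def w_plus_eq_w_minus inner_diff_left)

lemma mass_flux_bottom:
  assumes "N \<ge> 1"
  shows "mass_flux N zb Gb h u 0 p = Gb p"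
proof -
  have "interface zb h 0 = zb"
    by (rule ext) (simp add: interface_def)
  then show ?thesis
    using assms by (simp add: mass_flux_def)
qed


subsection \<open>Rheology\<close>

definition friction :: "real \<Rightarrow> real \<Rightarrow> real \<Rightarrow> real \<Rightarrow> real" where
  "friction \<mu>\<^sub>s \<mu>\<^sub>2 I\<^sub>0 I = \<mu>\<^sub>s + (\<mu>\<^sub>2 - \<mu>\<^sub>s) / (I\<^sub>0 + I) * I"

definition shear ::
  "nat \<Rightarrow> (nat \<Rightarrow> point \<Rightarrow> real) \<Rightarrow> (nat \<Rightarrow> point \<Rightarrow> real ^ 2) \<Rightarrow> nat \<Rightarrow> point \<Rightarrow> real ^ 2" where
  "shear N h u \<alpha> p = (u (\<alpha> + 1) p - u \<alpha> p) /\<^sub>R (if \<alpha> < N then mid_dist h \<alpha> p else h N p)"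

definition pressure ::
  "real \<Rightarrow> real \<Rightarrow> nat \<Rightarrow> (point \<Rightarrow> real) \<Rightarrow> (nat \<Rightarrow> point \<Rightarrow> real) \<Rightarrow> nat \<Rightarrow> point \<Rightarrow> real" where
  "pressure \<rho> g N p\<^sub>S h \<alpha> p = p\<^sub>S p + \<rho> * g * (\<Sum>\<beta>=\<alpha>+1..N. h \<beta> p)"

definition inertial_number :: "real \<Rightarrow> real \<Rightarrow> real \<Rightarrow> real ^ 2 \<Rightarrow> real" where
  "inertial_number d\<^sub>s \<rho>\<^sub>s P Q = d\<^sub>s * norm Q / sqrt (P / \<rho>\<^sub>s)"

definition eta_max :: "real \<Rightarrow> real \<Rightarrow> real \<Rightarrow> real" where
  "eta_max \<rho> g H = 250 * \<rho> * sqrt (g * H ^ 3)"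

text \<open>
  The values \<open>\<eta>\<close> admissible as a viscosity for the pressure \<open>P\<close>, the shear \<open>Q\<close> and the
  regularisation bound \<open>\<eta>\<^sub>M\<close>. For \<open>P = 0\<close> the product \<open>friction \<dots> * P\<close> is \<open>0\<close>,
  whatever the (there meaningless) inertial number.
\<close>

definition viscosity_law ::
  "real \<Rightarrow> real \<Rightarrow> real \<Rightarrow> real \<Rightarrow> real \<Rightarrow> real \<Rightarrow> real \<Rightarrow> real ^ 2 \<Rightarrow> real \<Rightarrow> bool" where
  "viscosity_law d\<^sub>s \<rho>\<^sub>s I\<^sub>0 \<mu>\<^sub>s \<mu>\<^sub>2 \<eta>\<^sub>M P Q \<eta> \<longleftrightarrow>
     (if P = 0 \<and> Q = 0 then 0 \<le> \<eta> \<and> \<eta> \<le> \<eta>\<^sub>M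
      else \<eta> = (let \<tau> = friction \<mu>\<^sub>s \<mu>\<^sub>2 I\<^sub>0 (inertial_number d\<^sub>s \<rho>\<^sub>s P Q) * P
                in \<tau> / max (norm Q) (\<tau> / \<eta>\<^sub>M)))"

text \<open>\<open>e\<close> is a reading of \<open>v / norm v\<close> that is multivalued at \<open>v = 0\<close>.\<close>

definition unit_direction :: "real ^ 2 \<Rightarrow> real ^ 2 \<Rightarrow> bool" where
  "unit_direction v e \<longleftrightarrow> (if v = 0 then norm e \<le> 1 else e = v /\<^sub>R norm v)"


subsection \<open>Energy\<close>

definition energy ::
  "real \<Rightarrow> real \<Rightarrow> nat \<Rightarrow> (point \<Rightarrow> real) \<Rightarrow> (point \<Rightarrow> real) \<Rightarrow> (nat \<Rightarrow> point \<Rightarrow> real)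
   \<Rightarrow> (nat \<Rightarrow> point \<Rightarrow> real ^ 2) \<Rightarrow> nat \<Rightarrow> point \<Rightarrow> real" where
  "energy \<rho> g N zb p\<^sub>S h u \<alpha> p =
     h \<alpha> p * ((norm (u \<alpha> p))\<^sup>2 / 2 + p\<^sub>S p / \<rho> + g * (zb p + total_height N h p / 2))"

end

theory Submission
  imports Defs
begin

text \<open>
  The energy balance is in fact an equality. Take the inner product of the momentum equation of
  layer \<open>\<alpha>\<close> with \<open>u \<alpha>\<close>. By the mass equation of the layer, the diagonal parts of the exchange terms
  cancel, and what remains of them, \<open>\<rho> / 2 * G \<alpha> * (u (\<alpha> + 1) \<bullet> u \<alpha>)\<close>, telescopes to \<open>0\<close> over the
  layers. Summation by parts turns the work of the stresses into the dissipation terms. The pressure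
  and gravity forces add up to the gradient of the single potential \<open>p\<^sub>S + \<rho> * g * (zb + H)\<close>, whose
  work is evaluated with the sum of the mass equations, which has the right-hand side \<open>- Gb\<close>.
\<close>

section \<open>Calculus of the partial derivatives\<close>

text \<open>\<open>dt\<close> is a derivative along the line \<open>s \<mapsto> (s, snd p)\<close>,
  so the chain rule evaluates the full derivative in the direction \<open>(1, 0)\<close>. With this
  lemma and its analogue for \<open>dx\<close>, each rule for partial derivatives is read off from
  one for \<open>has_derivative\<close>.\<close>

lemma dt_has_derivative:
  assumes "(f has_derivative f') (at p)"
  shows "dt f p = f' (1, 0)"
proof -
  have "((\<lambda>s. (s, snd p)) has_derivative (\<lambda>s. (s, 0))) (at (fst p))"
    by (auto intro!: derivative_eq_intros)
  then have "((\<lambda>s. f (s, snd p)) has_derivative (\<lambda>s. f' (s, 0))) (at (fst p))"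
    by (rule has_derivative_compose) (simp add: assms)
  moreover have "(\<lambda>s. f' (s, 0)) = (\<lambda>s. s *\<^sub>R f' (1, 0))"
  proof
    show "f' (s, 0) = s *\<^sub>R f' (1, 0)" for s
      using linear_scale[OF has_derivative_linear[OF assms], of s "(1, 0)"] by simp
  qed
  ultimately show ?thesis
    unfolding dt_def by (intro vector_derivative_at) (simp only: has_vector_derivative_def)
qed

lemma dx_has_derivative:
  assumes "(f has_derivative f') (at p)"
  shows "dx j f p = f' (0, axis j 1)"
proof -
  have "((\<lambda>s. (fst p, snd p + s *\<^sub>R axis j 1)) has_derivative (\<lambda>s. (0, s *\<^sub>R axis j 1))) (at 0)"
    by (auto intro!: derivative_eq_intros)
  then have "((\<lambda>s. f (fst p, snd p + s *\<^sub>R axis j 1)) has_derivative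
      (\<lambda>s. f' (0, s *\<^sub>R axis j 1))) (at 0)"
    by (rule has_derivative_compose) (simp add: assms)
  moreover have "(\<lambda>s. f' (0, s *\<^sub>R axis j 1)) = (\<lambda>s. s *\<^sub>R f' (0, axis j 1))"
  proof
    show "f' (0, s *\<^sub>R axis j 1) = s *\<^sub>R f' (0, axis j 1)" for s
      using linear_scale[OF has_derivative_linear[OF assms], of s "(0, axis j 1)"] by simp
  qed
  ultimately show ?thesis
    unfolding dx_def by (intro vector_derivative_at) (simp only: has_vector_derivative_def)
qed

lemma
  assumes "bounded_linear L" and "f differentiable (at p)"
  shows dt_bounded_linear: "dt (\<lambda>q. L (f q)) p = L (dt f p)"
    and dx_bounded_linear: "dx j (\<lambda>q. L (f q)) p = L (dx j f p)"
proof -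
  from assms(2) obtain f' where f': "(f has_derivative f') (at p)"
    unfolding differentiable_def by blast
  note D = bounded_linear.has_derivative[OF assms(1) f']
  show "dt (\<lambda>q. L (f q)) p = L (dt f p)"
    by (simp add: dt_has_derivative[OF D] dt_has_derivative[OF f'])
  show "dx j (\<lambda>q. L (f q)) p = L (dx j f p)"
    by (simp add: dx_has_derivative[OF D] dx_has_derivative[OF f'])
qed

text \<open>One product rule for all bounded bilinear maps covers products of reals, scalings of
  vectors and inner products alike.\<close>

lemma
  assumes "bounded_bilinear B" and "f differentiable (at p)" and "k differentiable (at p)"
  shows dt_bounded_bilinear: "dt (\<lambda>q. B (f q) (k q)) p = B (f p) (dt k p) + B (dt f p) (k p)"
    and dx_bounded_bilinear: "dx j (\<lambda>q. B (f q) (k q)) p = B (f p) (dx j k p) + B (dx j f p) (k p)"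
proof -
  from assms(2,3) obtain f' k' where f': "(f has_derivative f') (at p)"
      and k': "(k has_derivative k') (at p)"
    unfolding differentiable_def by blast
  note D = bounded_bilinear.FDERIV[OF assms(1) f' k']
  show "dt (\<lambda>q. B (f q) (k q)) p = B (f p) (dt k p) + B (dt f p) (k p)"
    by (simp add: dt_has_derivative[OF D] dt_has_derivative[OF f'] dt_has_derivative[OF k'])
  show "dx j (\<lambda>q. B (f q) (k q)) p = B (f p) (dx j k p) + B (dx j f p) (k p)"
    by (simp add: dx_has_derivative[OF D] dx_has_derivative[OF f'] dx_has_derivative[OF k'])
qed

lemma
  assumes "f differentiable (at p)" and "k differentiable (at p)"
  shows dt_add: "dt (\<lambda>q. f q + k q) p = dt f p + dt k p"
    and dx_add: "dx j (\<lambda>q. f q + k q) p = dx j f p + dx j k p"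
proof -
  from assms obtain f' k' where f': "(f has_derivative f') (at p)"
      and k': "(k has_derivative k') (at p)"
    unfolding differentiable_def by blast
  note D = has_derivative_add[OF f' k']
  show "dt (\<lambda>q. f q + k q) p = dt f p + dt k p"
    by (simp add: dt_has_derivative[OF D] dt_has_derivative[OF f'] dt_has_derivative[OF k'])
  show "dx j (\<lambda>q. f q + k q) p = dx j f p + dx j k p"
    by (simp add: dx_has_derivative[OF D] dx_has_derivative[OF f'] dx_has_derivative[OF k'])
qed

lemma
  assumes "\<And>i. i \<in> A \<Longrightarrow> f i differentiable (at p)"
  shows dt_sum: "dt (\<lambda>q. \<Sum>i\<in>A. f i q) p = (\<Sum>i\<in>A. dt (f i) p)"
    and dx_sum: "dx j (\<lambda>q. \<Sum>i\<in>A. f i q) p = (\<Sum>i\<in>A. dx j (f i) p)"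
proof -
  \<comment> \<open>\<open>frechet_derivative\<close> names the derivatives for all indices at once,
    which avoids choosing one for each index.\<close>
  from assms have f': "\<And>i. i \<in> A \<Longrightarrow> (f i has_derivative frechet_derivative (f i) (at p)) (at p)"
    by (simp add: frechet_derivative_works)
  have D: "((\<lambda>q. \<Sum>i\<in>A. f i q) has_derivative (\<lambda>v. \<Sum>i\<in>A. frechet_derivative (f i) (at p) v)) (at p)"
    by (intro has_derivative_sum f')
  show "dt (\<lambda>q. \<Sum>i\<in>A. f i q) p = (\<Sum>i\<in>A. dt (f i) p)"
    unfolding dt_has_derivative[OF D] by (intro sum.cong refl) (simp add: dt_has_derivative[OF f'])
  show "dx j (\<lambda>q. \<Sum>i\<in>A. f i q) p = (\<Sum>i\<in>A. dx j (f i) p)"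
    unfolding dx_has_derivative[OF D] by (intro sum.cong refl) (simp add: dx_has_derivative[OF f'])
qed

lemmas dt_mult_right = dt_bounded_linear[OF bounded_linear_mult_right]
lemmas dx_mult_right = dx_bounded_linear[OF bounded_linear_mult_right]
lemmas dt_mult = dt_bounded_bilinear[OF bounded_bilinear_mult]
lemmas dx_mult = dx_bounded_bilinear[OF bounded_bilinear_mult]
lemmas dt_scaleR = dt_bounded_bilinear[OF bounded_bilinear_scaleR]
lemmas dt_inner = dt_bounded_bilinear[OF bounded_bilinear_inner]
lemmas dx_inner = dx_bounded_bilinear[OF bounded_bilinear_inner]
lemmas dx_vec_nth = dx_bounded_linear[OF bounded_linear_vec_nth]

section \<open>Components, gradient, divergence and tensor divergence\<close>

lemma differentiable_vec_nth:
  assumes "F differentiable F'"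
  shows "(\<lambda>q. F q $ j) differentiable F'"
  using assms unfolding differentiable_def
  by (auto intro: bounded_linear.has_derivative[OF bounded_linear_vec_nth])

lemma grad_add:
  assumes "f differentiable (at p)" and "k differentiable (at p)"
  shows "grad (\<lambda>q. f q + k q) p = grad f p + grad k p"
  using assms by (simp add: grad_def vec_eq_iff dx_add)

lemma grad_cmult:
  assumes "f differentiable (at p)"
  shows "grad (\<lambda>q. c * f q) p = c *\<^sub>R grad f p"
  using assms by (simp add: grad_def vec_eq_iff dx_mult_right)

lemma divg_add:
  assumes "F differentiable (at p)" and "K differentiable (at p)"
  shows "divg (\<lambda>q. F q + K q) p = divg F p + divg K p"
  using assms by (simp add: divg_def dx_add differentiable_vec_nth sum.distrib)

lemma divg_sum:
  assumes "\<And>i. i \<in> A \<Longrightarrow> F i differentiable (at p)"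
  shows "divg (\<lambda>q. \<Sum>i\<in>A. F i q) p = (\<Sum>i\<in>A. divg (F i) p)"
proof -
  have "divg (\<lambda>q. \<Sum>i\<in>A. F i q) p = (\<Sum>j\<in>UNIV. \<Sum>i\<in>A. dx j (\<lambda>q. F i q $ j) p)"
    unfolding divg_def sum_component
    by (intro sum.cong refl dx_sum differentiable_vec_nth assms)
  then show ?thesis
    by (subst (asm) sum.swap) (simp add: divg_def)
qed

lemma divg_scaleR:
  assumes "f differentiable (at p)" and "F differentiable (at p)"
  shows "divg (\<lambda>q. f q *\<^sub>R F q) p = f p * divg F p + grad f p \<bullet> F p"
  using assms
  by (simp add: divg_def grad_def inner_vec_def dx_mult differentiable_vec_nth
      sum.distrib sum_distrib_left)

lemma divg_cscaleR:
  assumes "F differentiable (at p)"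
  shows "divg (\<lambda>q. c *\<^sub>R F q) p = c * divg F p"
  using assms by (simp add: divg_def dx_mult_right differentiable_vec_nth sum_distrib_left)

text \<open>\<open>div_tensor\<close> differentiates along the second index of the tensor, which
  \<open>outer\<close> gives to its second factor. Hence \<open>K\<close> is the transporting field,
  and the product rule splits the divergence into the part \<open>divg K p *\<^sub>R F p\<close> and
  the convective derivative of \<open>F\<close> along \<open>K\<close>.\<close>

lemma inner_div_tensor_outer:
  assumes "F differentiable (at p)" and "K differentiable (at p)"
  shows "v \<bullet> div_tensor (\<lambda>q. outer (F q) (K q)) p =
    (v \<bullet> F p) * divg K p + (\<Sum>j\<in>UNIV. K p $ j * (v \<bullet> dx j F p))"
proof -
  have "div_tensor (\<lambda>q. outer (F q) (K q)) p =
      divg K p *\<^sub>R F p + (\<Sum>j\<in>UNIV. K p $ j *\<^sub>R dx j F p)"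
    using assms
    by (simp add: vec_eq_iff div_tensor_def outer_def divg_def dx_mult dx_vec_nth
        differentiable_vec_nth sum.distrib sum_distrib_left mult.commute)
  then show ?thesis
    by (simp add: inner_add_right inner_sum_right mult.commute)
qed

lemma smooth_on_differentiable:
  assumes "smooth_on S f" and "p \<in> S"
  shows "f differentiable (at p)"
proof -
  have "Ck_on (Suc 0) S f"
    using assms(1) unfolding smooth_on_def by blast
  then show ?thesis
    using assms(2) by simp
qed


section \<open>Energy balance\<close>

text \<open>Let \<open>e\<close> be half the squared norm of \<open>v\<close>. Every partial
  derivative satisfies \<open>v \<bullet> \<partial>v = \<partial>e\<close>, while
  \<open>v \<bullet> v\<close> is \<open>2 * e\<close>. One of these two copies of \<open>e\<close>
  completes the derivatives of the energy \<open>k = a * e\<close> and of its flux; the other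
  multiplies the mass balance of \<open>a\<close>. No mass equation is assumed, so a layer that
  exchanges mass is covered.\<close>

lemma kinetic_energy_balance:
  fixes a :: "point \<Rightarrow> real" and v :: "point \<Rightarrow> real ^ 2"
  assumes a: "a differentiable (at p)" and v: "v differentiable (at p)"
  defines "k \<equiv> \<lambda>q. a q * ((norm (v q))\<^sup>2 / 2)"
  shows "v p \<bullet> (dt (\<lambda>q. a q *\<^sub>R v q) p + div_tensor (\<lambda>q. outer (v q) (a q *\<^sub>R v q)) p)
    = dt k p + divg (\<lambda>q. k q *\<^sub>R v q) p
      + (norm (v p))\<^sup>2 / 2 * (dt a p + divg (\<lambda>q. a q *\<^sub>R v q) p)"
proof -
  \<comment> \<open>The inner product replaces the squared norm because the norm itself is not
    differentiable where \<open>v\<close> vanishes.\<close>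
  define e where "e q = 1 / 2 * (v q \<bullet> v q)" for q
  have e: "e differentiable (at p)"
    unfolding e_def using v by (intro differentiable_mult differentiable_inner) auto
  have av: "(\<lambda>q. a q *\<^sub>R v q) differentiable (at p)"
    by (intro differentiable_scaleR a v)
  have vv: "(\<lambda>q. v q \<bullet> v q) differentiable (at p)"
    by (intro differentiable_inner v)
  have k: "k = (\<lambda>q. a q * e q)"
    by (simp add: k_def e_def power2_norm_eq_inner)
  \<comment> \<open>Grouping the flux around \<open>a q *\<^sub>R v q\<close> makes the product rule
    produce the divergence that occurs in the mass balance.\<close>
  have kv: "(\<lambda>q. k q *\<^sub>R v q) = (\<lambda>q. e q *\<^sub>R (a q *\<^sub>R v q))"
    by (simp add: k mult.commute)
  have dte: "dt e p = v p \<bullet> dt v p"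
    unfolding e_def by (subst dt_mult_right) (simp_all add: vv v dt_inner inner_commute)
  have dxe: "dx j e p = v p \<bullet> dx j v p" for j
    unfolding e_def by (subst dx_mult_right) (simp_all add: vv v dx_inner inner_commute)
  \<comment> \<open>The convective derivative of \<open>v\<close>, tested with \<open>v\<close>,
    becomes a directional derivative of \<open>e\<close>.\<close>
  have "w \<bullet> grad e p = (\<Sum>j\<in>UNIV. w $ j * (v p \<bullet> dx j v p))" for w
    by (simp add: inner_vec_def[of w] grad_def dxe)
  then have conv: "(\<Sum>j\<in>UNIV. (a p *\<^sub>R v p) $ j * (v p \<bullet> dx j v p)) = grad e p \<bullet> (a p *\<^sub>R v p)"
    by (metis inner_commute)
  have 1: "(norm (v p))\<^sup>2 / 2 = e p" "v p \<bullet> v p = 2 * e p"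
    by (simp_all add: e_def power2_norm_eq_inner)
  have 2: "v p \<bullet> dt (\<lambda>q. a q *\<^sub>R v q) p = dt k p + e p * dt a p"
    using a v e by (simp add: dt_scaleR k dt_mult dte inner_add_right 1)
  have 3: "divg (\<lambda>q. k q *\<^sub>R v q) p = e p * divg (\<lambda>q. a q *\<^sub>R v q) p + grad e p \<bullet> (a p *\<^sub>R v p)"
    unfolding kv by (rule divg_scaleR[OF e av])
  show ?thesis
    unfolding inner_add_right inner_div_tensor_outer[OF v av] conv 1 2 3
    by (simp add: algebra_simps)
qed

text \<open>The derivative of \<open>H * (P\<^sub>0 + c * H / 2)\<close> with respect to
  \<open>H\<close> is \<open>P\<^sub>0 + c * H\<close>, the very factor that the flux carries.
  Therefore \<open>dt H\<close> and \<open>divg m\<close> appear with a common factor and can be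
  combined by mass conservation.\<close>

lemma potential_energy_balance:
  fixes H P\<^sub>0 :: "point \<Rightarrow> real" and m :: "point \<Rightarrow> real ^ 2"
  assumes H: "H differentiable (at p)" and P: "P\<^sub>0 differentiable (at p)"
    and m: "m differentiable (at p)"
  shows "dt (\<lambda>q. H q * (P\<^sub>0 q + c * H q / 2)) p + divg (\<lambda>q. (P\<^sub>0 q + c * H q) *\<^sub>R m q) p
    = H p * dt P\<^sub>0 p + m p \<bullet> grad (\<lambda>q. P\<^sub>0 q + c * H q) p
      + (P\<^sub>0 p + c * H p) * (dt H p + divg m p)"
proof -
  have cH: "(\<lambda>q. x * H q) differentiable (at p)" for x
    by (intro differentiable_mult H) auto
  have PH: "(\<lambda>q. P\<^sub>0 q + x * H q) differentiable (at p)" for x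
    by (intro differentiable_add P cH)
  \<comment> \<open>The constant \<open>c / 2\<close> stands in front so that \<open>PH\<close> and
    \<open>dt_mult_right\<close> apply; deleting \<open>times_divide_eq_left\<close> keeps the
    simplifier from moving the division back.\<close>
  have "dt (\<lambda>q. H q * (P\<^sub>0 q + c / 2 * H q)) p
      = H p * (dt P\<^sub>0 p + c / 2 * dt H p) + dt H p * (P\<^sub>0 p + c / 2 * H p)"
    by (simp add: dt_mult[OF H PH] dt_add[OF P cH] dt_mult_right[OF H] del: times_divide_eq_left)
  moreover have "divg (\<lambda>q. (P\<^sub>0 q + c * H q) *\<^sub>R m q) p
      = (P\<^sub>0 p + c * H p) * divg m p + m p \<bullet> grad (\<lambda>q. P\<^sub>0 q + c * H q) p"
    by (simp add: divg_scaleR PH m inner_commute)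
  ultimately show ?thesis
    by (simp add: field_simps)
qed

text \<open>The stress at an inner interface acts on the two adjacent layers with opposite signs, so
  its work pairs it with the velocity jump. \<open>K 0\<close> and \<open>K N\<close> each act on a
  single layer and give the boundary terms.\<close>

lemma sum_layer_stress:
  fixes K u :: "nat \<Rightarrow> 'a::real_inner"
  assumes "N \<ge> 1"
  shows "(\<Sum>\<alpha>=1..N. u \<alpha> \<bullet> (K (\<alpha> - 1) - K \<alpha>))
    = u 1 \<bullet> K 0 - u N \<bullet> K N + (\<Sum>\<alpha>=1..N-1. (u (\<alpha> + 1) - u \<alpha>) \<bullet> K \<alpha>)"
  using assms
proof (induction N rule: dec_induct)
  case base
  show ?case by (simp add: inner_diff_right)
next
  case (step n)
  \<comment> \<open>Exposing the predecessor of \<open>n\<close> lets the upper bound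
    \<open>n - 1\<close> of the inner sum simplify.\<close>
  then obtain k where "n = Suc k"
    by (cases n) auto
  with step show ?case
    by (simp add: inner_diff_right inner_diff_left)
qed

theorem theorem1:
  fixes \<rho> g d\<^sub>s \<rho>\<^sub>s I\<^sub>0 \<mu>\<^sub>s \<mu>\<^sub>2 :: real
    and N :: nat
    and \<Omega> :: "(real \<times> (real ^ 2)) set"
    and zb p\<^sub>S Gb Ib :: "real \<times> (real ^ 2) \<Rightarrow> real"
    and h \<eta> :: "nat \<Rightarrow> real \<times> (real ^ 2) \<Rightarrow> real"
    and u K :: "nat \<Rightarrow> real \<times> (real ^ 2) \<Rightarrow> real ^ 2"
    and e :: "real \<times> (real ^ 2) \<Rightarrow> real ^ 2"
  defines "H \<equiv> total_height N h"
    and "G \<equiv> mass_flux N zb Gb h u"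
    and "Q \<equiv> shear N h u"
    and "E \<equiv> energy \<rho> g N zb p\<^sub>S h u"
  assumes constants: "\<rho> > 0" "g > 0" "d\<^sub>s > 0" "\<rho>\<^sub>s > 0" "I\<^sub>0 > 0" "\<mu>\<^sub>s > 0" "\<mu>\<^sub>2 > \<mu>\<^sub>s"
    and N: "N \<ge> 1"
    and dom: "open \<Omega>"
    and smooth_data: "smooth_on \<Omega> zb" "smooth_on \<Omega> p\<^sub>S" "smooth_on \<Omega> Gb"
    and smooth_sol: "\<And>\<alpha>. \<alpha> \<in> {1..N} \<Longrightarrow> smooth_on \<Omega> (h \<alpha>)"
      "\<And>\<alpha>. \<alpha> \<in> {1..N} \<Longrightarrow> smooth_on \<Omega> (u \<alpha>)"
    and pS_nonneg: "\<And>p. p \<in> \<Omega> \<Longrightarrow> p\<^sub>S p \<ge> 0"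
    and h_pos: "\<And>\<alpha> p. \<alpha> \<in> {1..N} \<Longrightarrow> p \<in> \<Omega> \<Longrightarrow> h \<alpha> p > 0"
    and u_outside: "\<And>p. p \<in> \<Omega> \<Longrightarrow> u 0 p = 0" "\<And>p. p \<in> \<Omega> \<Longrightarrow> u (N + 1) p = 0"
    and no_atm_transfer: "\<And>p. p \<in> \<Omega> \<Longrightarrow> G N p = 0"
    and viscosity: "\<And>\<alpha> p. \<alpha> \<in> {1..N} \<Longrightarrow> p \<in> \<Omega> \<Longrightarrow>
      viscosity_law d\<^sub>s \<rho>\<^sub>s I\<^sub>0 \<mu>\<^sub>s \<mu>\<^sub>2 (eta_max \<rho> g (H p)) (pressure \<rho> g N p\<^sub>S h \<alpha> p) (Q \<alpha> p) (\<eta> \<alpha> p)"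
    and stress: "\<And>\<alpha> p. \<alpha> \<in> {1..N} \<Longrightarrow> p \<in> \<Omega> \<Longrightarrow> K \<alpha> p = - (\<eta> \<alpha> p *\<^sub>R Q \<alpha> p)"
    and Ib_nonneg: "\<And>p. p \<in> \<Omega> \<Longrightarrow> Ib p \<ge> 0"
    and bottom_direction: "\<And>p. p \<in> \<Omega> \<Longrightarrow> unit_direction (u 1 p) (e p)"
    and bottom_stress: "\<And>p. p \<in> \<Omega> \<Longrightarrow>
      K 0 p = - ((friction \<mu>\<^sub>s \<mu>\<^sub>2 I\<^sub>0 (Ib p) * \<rho> * g * H p) *\<^sub>R e p)"
    and mass: "\<And>\<alpha> p. \<alpha> \<in> {1..N} \<Longrightarrow> p \<in> \<Omega> \<Longrightarrow>
      dt (h \<alpha>) p + divg (\<lambda>q. h \<alpha> q *\<^sub>R u \<alpha> q) p = G \<alpha> p - G (\<alpha> - 1) p"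
    and momentum: "\<And>\<alpha> p. \<alpha> \<in> {1..N} \<Longrightarrow> p \<in> \<Omega> \<Longrightarrow>
      \<rho> *\<^sub>R dt (\<lambda>q. h \<alpha> q *\<^sub>R u \<alpha> q) p
      + div_tensor (\<lambda>q. (\<rho> * h \<alpha> q) *\<^sub>R outer (u \<alpha> q) (u \<alpha> q)) p
      + h \<alpha> p *\<^sub>R grad p\<^sub>S p
      + (\<rho> * g * h \<alpha> p) *\<^sub>R grad (\<lambda>q. zb q + H q) p
      = K (\<alpha> - 1) p - K \<alpha> p
      + (1 / 2 * \<rho> * G \<alpha> p) *\<^sub>R (u (\<alpha> + 1) p + u \<alpha> p)
      - (1 / 2 * \<rho> * G (\<alpha> - 1) p) *\<^sub>R (u \<alpha> p + u (\<alpha> - 1) p)"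
  shows "\<forall>p\<in>\<Omega>.
      \<rho> * dt (\<lambda>q. \<Sum>\<alpha>=1..N. E \<alpha> q) p
      + \<rho> * divg (\<lambda>q. \<Sum>\<alpha>=1..N. (E \<alpha> q + g * h \<alpha> q * (H q / 2)) *\<^sub>R u \<alpha> q) p
      \<le> H p * dt (\<lambda>q. p\<^sub>S q + \<rho> * g * zb q) p
        - \<rho> * g * H p * norm (u 1 p) * friction \<mu>\<^sub>s \<mu>\<^sub>2 I\<^sub>0 (Ib p)
        - (norm (u N p))\<^sup>2 / h N p * \<eta> N p
        - (\<Sum>\<alpha>=1..N-1. (norm (u (\<alpha> + 1) p - u \<alpha> p))\<^sup>2 / mid_dist h \<alpha> p * \<eta> \<alpha> p)
        - Gb p * (p\<^sub>S p + \<rho> * g * (zb p + H p))"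
proof
  fix p assume p: "p \<in> \<Omega>"
  show "\<rho> * dt (\<lambda>q. \<Sum>\<alpha>=1..N. E \<alpha> q) p
      + \<rho> * divg (\<lambda>q. \<Sum>\<alpha>=1..N. (E \<alpha> q + g * h \<alpha> q * (H q / 2)) *\<^sub>R u \<alpha> q) p
      \<le> H p * dt (\<lambda>q. p\<^sub>S q + \<rho> * g * zb q) p
        - \<rho> * g * H p * norm (u 1 p) * friction \<mu>\<^sub>s \<mu>\<^sub>2 I\<^sub>0 (Ib p)
        - (norm (u N p))\<^sup>2 / h N p * \<eta> N p
        - (\<Sum>\<alpha>=1..N-1. (norm (u (\<alpha> + 1) p - u \<alpha> p))\<^sup>2 / mid_dist h \<alpha> p * \<eta> \<alpha> p)
        - Gb p * (p\<^sub>S p + \<rho> * g * (zb p + H p))"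
    (is "?L \<le> ?R")
  proof -

    \<comment> \<open>Auxiliary fields and their differentiability\<close>
    have h_diff: "h \<alpha> differentiable (at p)" and u_diff: "u \<alpha> differentiable (at p)"
      if "\<alpha> \<in> {1..N}" for \<alpha>
      using smooth_on_differentiable p smooth_sol that by blast+
    have zb: "zb differentiable (at p)" and pS: "p\<^sub>S differentiable (at p)"
      using smooth_on_differentiable p smooth_data by blast+
    \<comment> \<open>\<open>P\<close> is the common potential of the pressure and gravity forces,
      and \<open>P\<^sub>0\<close> is its part from the prescribed data. Per unit of horizontal
      area, layer \<alpha> has mass \<open>a \<alpha>\<close>, volume flux \<open>m \<alpha>\<close>
      and kinetic energy \<open>k \<alpha>\<close>.\<close>
    define P\<^sub>0 where "P\<^sub>0 q = p\<^sub>S q + \<rho> * g * zb q" for q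
    define c where "c = \<rho> * g"
    define P where "P q = P\<^sub>0 q + c * H q" for q
    define m where "m \<alpha> q = h \<alpha> q *\<^sub>R u \<alpha> q" for \<alpha> q
    define a where "a \<alpha> q = \<rho> * h \<alpha> q" for \<alpha> q
    define k where "k \<alpha> q = a \<alpha> q * ((norm (u \<alpha> q))\<^sup>2 / 2)" for \<alpha> q
    have H_eq: "H = (\<lambda>q. \<Sum>\<alpha>=1..N. h \<alpha> q)"
      by (rule ext) (simp add: H_def total_height_def)
    have cz: "(\<lambda>q. \<rho> * g * zb q) differentiable (at p)"
      by (intro differentiable_mult zb) auto
    have P0: "P\<^sub>0 differentiable (at p)"
      unfolding P\<^sub>0_def by (intro differentiable_add pS cz)
    have Hd: "H differentiable (at p)"
      unfolding H_eq by (intro differentiable_sum ballI h_diff) auto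
    have m: "m \<alpha> differentiable (at p)" if "\<alpha> \<in> {1..N}" for \<alpha>
      unfolding m_def using that by (intro differentiable_scaleR h_diff u_diff)
    have M: "(\<lambda>q. \<Sum>\<alpha>=1..N. m \<alpha> q) differentiable (at p)"
      by (intro differentiable_sum ballI m) auto
    have a: "a \<alpha> differentiable (at p)" if "\<alpha> \<in> {1..N}" for \<alpha>
      unfolding a_def using that by (intro differentiable_mult h_diff) auto
    have k: "k \<alpha> differentiable (at p)" if "\<alpha> \<in> {1..N}" for \<alpha>
      unfolding k_def power2_norm_eq_inner divide_inverse using that
      by (intro differentiable_mult differentiable_inner a u_diff) auto
    have ku: "(\<lambda>q. k \<alpha> q *\<^sub>R u \<alpha> q) differentiable (at p)" if "\<alpha> \<in> {1..N}" for \<alpha>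
      using that by (intro differentiable_scaleR k u_diff)
    \<comment> \<open>Since the thicknesses add up to \<open>H\<close>, \<open>V\<close> is
      \<open>\<rho>\<close> times the non-kinetic part of the total energy. \<open>V\<close> and
      \<open>F\<close> have the form required by \<open>potential_energy_balance\<close>.\<close>
    define V where "V q = H q * (P\<^sub>0 q + c * H q / 2)" for q
    define F where "F q = P q *\<^sub>R (\<Sum>\<alpha>=1..N. m \<alpha> q)" for q
    have cH: "(\<lambda>q. c * H q) differentiable (at p)"
      by (intro differentiable_mult Hd) auto
    have Pd: "P differentiable (at p)"
      unfolding P_def by (intro differentiable_add P0 cH)
    have V: "V differentiable (at p)"
      unfolding V_def divide_inverse by (intro differentiable_mult differentiable_add P0 Hd) auto
    have F: "F differentiable (at p)"
      unfolding F_def by (intro differentiable_scaleR Pd M)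
    have sum_k: "(\<lambda>q. \<Sum>\<alpha>=1..N. k \<alpha> q) differentiable (at p)"
      by (intro differentiable_sum ballI k) auto
    have sum_ku: "(\<lambda>q. \<Sum>\<alpha>=1..N. k \<alpha> q *\<^sub>R u \<alpha> q) differentiable (at p)"
      by (intro differentiable_sum ballI ku) auto

    \<comment> \<open>Splitting the energy and its flux into kinetic and potential parts\<close>
    have E_eq: "E \<alpha> q = 1 / \<rho> * (k \<alpha> q + h \<alpha> q * (P\<^sub>0 q + c * H q / 2))" for \<alpha> q
      using constants(1)
      by (simp add: E_def energy_def k_def a_def P\<^sub>0_def c_def H_def field_simps)
    have E_sum: "(\<Sum>\<alpha>=1..N. E \<alpha> q) = 1 / \<rho> * ((\<Sum>\<alpha>=1..N. k \<alpha> q) + V q)" for q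
      unfolding E_eq sum_distrib_left[symmetric] sum.distrib
      by (simp add: H_eq V_def sum_distrib_right)
    have flux: "(\<Sum>\<alpha>=1..N. (E \<alpha> q + g * h \<alpha> q * (H q / 2)) *\<^sub>R u \<alpha> q)
        = (1 / \<rho>) *\<^sub>R ((\<Sum>\<alpha>=1..N. k \<alpha> q *\<^sub>R u \<alpha> q) + F q)" for q
    proof -
      \<comment> \<open>The term \<open>g * h \<alpha> q * (H q / 2)\<close> in the flux raises the
        contribution \<open>c * H q / 2\<close> of the energy to \<open>c * H q\<close>, which
        completes the potential \<open>P q\<close>.\<close>
      have "E \<alpha> q + g * h \<alpha> q * (H q / 2) = 1 / \<rho> * (k \<alpha> q + P q * h \<alpha> q)" for \<alpha>
        unfolding E_eq P_def c_def using constants(1) by (simp add: field_simps)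
      then have "(E \<alpha> q + g * h \<alpha> q * (H q / 2)) *\<^sub>R u \<alpha> q
          = (1 / \<rho>) *\<^sub>R (k \<alpha> q *\<^sub>R u \<alpha> q + P q *\<^sub>R m \<alpha> q)" for \<alpha>
        by (simp only: scaleR_scaleR[symmetric] scaleR_add_left m_def)
      then show ?thesis
        by (simp only: F_def scaleR_sum_right scaleR_add_right sum.distrib)
    qed
    have dt_k: "dt (\<lambda>q. \<Sum>\<alpha>=1..N. k \<alpha> q) p = (\<Sum>\<alpha>=1..N. dt (k \<alpha>) p)"
      by (intro dt_sum k)
    have divg_ku: "divg (\<lambda>q. \<Sum>\<alpha>=1..N. k \<alpha> q *\<^sub>R u \<alpha> q) p
        = (\<Sum>\<alpha>=1..N. divg (\<lambda>q. k \<alpha> q *\<^sub>R u \<alpha> q) p)"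
      by (intro divg_sum ku)
    have dt_H: "dt H p = (\<Sum>\<alpha>=1..N. dt (h \<alpha>) p)"
      unfolding H_eq by (intro dt_sum h_diff)
    have divg_M: "divg (\<lambda>q. \<Sum>\<alpha>=1..N. m \<alpha> q) p = (\<Sum>\<alpha>=1..N. divg (m \<alpha>) p)"
      by (intro divg_sum m)
    \<comment> \<open>Deleting \<open>One_nat_def\<close> keeps the lower summation bound as
      \<open>1\<close>, so that \<open>dt_k\<close> still matches; the same holds for
      \<open>divg_ku\<close> in \<open>divE\<close>.\<close>
    have dtE: "\<rho> * dt (\<lambda>q. \<Sum>\<alpha>=1..N. E \<alpha> q) p = (\<Sum>\<alpha>=1..N. dt (k \<alpha>) p) + dt V p"
      unfolding E_sum using constants(1)
      by (subst dt_mult_right) (simp_all add: differentiable_add sum_k V dt_add dt_k del: One_nat_def)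
    have divE: "\<rho> * divg (\<lambda>q. \<Sum>\<alpha>=1..N. (E \<alpha> q + g * h \<alpha> q * (H q / 2)) *\<^sub>R u \<alpha> q) p
        = (\<Sum>\<alpha>=1..N. divg (\<lambda>q. k \<alpha> q *\<^sub>R u \<alpha> q) p) + divg F p"
      unfolding flux using constants(1)
      by (subst divg_cscaleR) (simp_all add: differentiable_add sum_ku F divg_add divg_ku del: One_nat_def)

    \<comment> \<open>Total mass balance and potential energy\<close>
    have telescope: "(\<Sum>\<alpha>=1..N. f \<alpha> - f (\<alpha> - 1)) = f N - f 0" for f :: "nat \<Rightarrow> real"
      using N by (induction N rule: dec_induct) auto
    have "dt H p + divg (\<lambda>q. \<Sum>\<alpha>=1..N. m \<alpha> q) p = (\<Sum>\<alpha>=1..N. G \<alpha> p - G (\<alpha> - 1) p)"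
      unfolding dt_H divg_M sum.distrib[symmetric]
      by (intro sum.cong refl) (use mass[OF _ p] in \<open>simp add: m_def[abs_def]\<close>)
    also have "\<dots> = - Gb p"
      unfolding telescope[of "\<lambda>\<alpha>. G \<alpha> p"]
      using no_atm_transfer[OF p] mass_flux_bottom[OF N] by (simp add: G_def)
    finally have total_mass: "dt H p + divg (\<lambda>q. \<Sum>\<alpha>=1..N. m \<alpha> q) p = - Gb p" .
    \<comment> \<open>With \<open>- Gb p\<close> for the total mass balance, the last term of the
      general identity becomes \<open>- Gb p * P p\<close>, the bottom exchange term of the
      claim.\<close>
    have potential: "dt V p + divg F p
        = H p * dt P\<^sub>0 p + (\<Sum>\<alpha>=1..N. m \<alpha> p) \<bullet> grad P p - Gb p * P p"
      using potential_energy_balance[OF Hd P0 M, of c]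
      unfolding V_def[abs_def] F_def[abs_def] P_def[abs_def] total_mass by simp

    \<comment> \<open>Kinetic energy of a single layer\<close>
    have grad_P: "h \<alpha> p *\<^sub>R grad p\<^sub>S p + (\<rho> * g * h \<alpha> p) *\<^sub>R grad (\<lambda>q. zb q + H q) p
        = h \<alpha> p *\<^sub>R grad P p" for \<alpha>
      by (simp add: P_def[abs_def] P\<^sub>0_def[abs_def] c_def grad_add grad_cmult differentiable_add
          pS zb Hd cz cH[unfolded c_def] scaleR_add_right mult.commute mult.left_commute add.assoc)
    \<comment> \<open>The index \<open>\<alpha> - 1 + 1\<close> is kept on purpose: the subtracted
      exchange term is then literally the first one at \<open>\<alpha> - 1\<close>, as
      \<open>telescope\<close> requires. It equals \<alpha> because \<alpha> is at least 1.\<close>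
    have kinetic: "dt (k \<alpha>) p + divg (\<lambda>q. k \<alpha> q *\<^sub>R u \<alpha> q) p
        = u \<alpha> p \<bullet> (K (\<alpha> - 1) p - K \<alpha> p) - m \<alpha> p \<bullet> grad P p
          + \<rho> / 2 * (G \<alpha> p * (u (\<alpha> + 1) p \<bullet> u \<alpha> p) - G (\<alpha> - 1) p * (u (\<alpha> - 1 + 1) p \<bullet> u (\<alpha> - 1) p))"
      if \<alpha>: "\<alpha> \<in> {1..N}" for \<alpha>
    proof -
      have au: "a \<alpha> q *\<^sub>R u \<alpha> q = \<rho> *\<^sub>R m \<alpha> q" for q
        by (simp add: a_def m_def)
      \<comment> \<open>The factor \<open>\<rho> * h \<alpha> q\<close> moves into the second
        factor, so that the momentum is the transporting field as in
        \<open>kinetic_energy_balance\<close>.\<close>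
      have tensor: "(\<lambda>q. (\<rho> * h \<alpha> q) *\<^sub>R outer (u \<alpha> q) (u \<alpha> q)) = (\<lambda>q. outer (u \<alpha> q) (\<rho> *\<^sub>R m \<alpha> q))"
        by (rule ext) (simp add: outer_def m_def vec_eq_iff mult_ac)
      have dt_m: "dt (\<lambda>q. \<rho> *\<^sub>R m \<alpha> q) p = \<rho> *\<^sub>R dt (m \<alpha>) p"
        by (rule dt_bounded_linear[OF bounded_linear_scaleR_right m[OF \<alpha>]])
      have "dt (a \<alpha>) p + divg (\<lambda>q. \<rho> *\<^sub>R m \<alpha> q) p = \<rho> * (dt (h \<alpha>) p + divg (m \<alpha>) p)"
        by (simp add: a_def[abs_def] dt_mult_right h_diff[OF \<alpha>] divg_cscaleR m[OF \<alpha>] distrib_left)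
      also have "\<dots> = \<rho> * (G \<alpha> p - G (\<alpha> - 1) p)"
        using mass[OF \<alpha> p] by (simp add: m_def[abs_def])
      finally have layer_mass:
        "dt (a \<alpha>) p + divg (\<lambda>q. \<rho> *\<^sub>R m \<alpha> q) p = \<rho> * (G \<alpha> p - G (\<alpha> - 1) p)" .
      \<comment> \<open>\<open>X\<close> is the inertial part of the momentum equation. Its work is
        computed twice: from the forces by \<open>momentum\<close>, and from the energy by
        \<open>kinetic_energy_balance\<close>.\<close>
      define X where "X = dt (\<lambda>q. \<rho> *\<^sub>R m \<alpha> q) p + div_tensor (\<lambda>q. outer (u \<alpha> q) (\<rho> *\<^sub>R m \<alpha> q)) p"
      have "X + h \<alpha> p *\<^sub>R grad P p = K (\<alpha> - 1) p - K \<alpha> p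
          + (1 / 2 * \<rho> * G \<alpha> p) *\<^sub>R (u (\<alpha> + 1) p + u \<alpha> p)
          - (1 / 2 * \<rho> * G (\<alpha> - 1) p) *\<^sub>R (u \<alpha> p + u (\<alpha> - 1) p)"
        using momentum[OF \<alpha> p]
        unfolding X_def dt_m tensor grad_P[symmetric] m_def[symmetric] by (simp only: add.assoc)
      then have "X = K (\<alpha> - 1) p - K \<alpha> p
          + (1 / 2 * \<rho> * G \<alpha> p) *\<^sub>R (u (\<alpha> + 1) p + u \<alpha> p)
          - (1 / 2 * \<rho> * G (\<alpha> - 1) p) *\<^sub>R (u \<alpha> p + u (\<alpha> - 1) p) - h \<alpha> p *\<^sub>R grad P p"
        by (simp only: eq_diff_eq)
      then have "u \<alpha> p \<bullet> X = u \<alpha> p \<bullet> (K (\<alpha> - 1) p - K \<alpha> p)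
          + 1 / 2 * \<rho> * G \<alpha> p * (u (\<alpha> + 1) p \<bullet> u \<alpha> p + (norm (u \<alpha> p))\<^sup>2)
          - 1 / 2 * \<rho> * G (\<alpha> - 1) p * ((norm (u \<alpha> p))\<^sup>2 + u \<alpha> p \<bullet> u (\<alpha> - 1) p) - m \<alpha> p \<bullet> grad P p"
        by (simp only: inner_diff_right inner_add_right inner_scaleR_right power2_norm_eq_inner
            m_def inner_scaleR_left inner_commute[of "u (\<alpha> + 1) p"])
      moreover have "u \<alpha> p \<bullet> X = dt (k \<alpha>) p + divg (\<lambda>q. k \<alpha> q *\<^sub>R u \<alpha> q) p
          + (norm (u \<alpha> p))\<^sup>2 / 2 * (\<rho> * (G \<alpha> p - G (\<alpha> - 1) p))"
        using kinetic_energy_balance[OF a[OF \<alpha>] u_diff[OF \<alpha>]]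
        unfolding X_def au layer_mass k_def[abs_def] .
      moreover have "\<alpha> - 1 + 1 = \<alpha>"
        using \<alpha> by simp
      ultimately show ?thesis
        by (simp add: field_simps del: One_nat_def)
    qed

    \<comment> \<open>Work of the stresses\<close>
    have bottom: "u 1 p \<bullet> K 0 p = - (\<rho> * g * H p * norm (u 1 p) * friction \<mu>\<^sub>s \<mu>\<^sub>2 I\<^sub>0 (Ib p))"
    proof -
      \<comment> \<open>At zero velocity both sides vanish, whichever vector \<open>e p\<close>
        is.\<close>
      have "u 1 p \<bullet> e p = norm (u 1 p)"
        using bottom_direction[OF p]
        by (auto simp: unit_direction_def power2_norm_eq_inner[symmetric] power2_eq_square
            split: if_splits)
      then show ?thesis
        unfolding bottom_stress[OF p] by (simp add: mult_ac)
    qed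
    \<comment> \<open>As \<open>u (N + 1) p\<close> is zero, the shear at the surface is
      \<open>u N p\<close> divided by \<open>- h N p\<close>. The two minus signs cancel in
      \<open>K N p\<close>, which is therefore a nonnegative multiple of
      \<open>u N p\<close>.\<close>
    have surface: "u N p \<bullet> K N p = (norm (u N p))\<^sup>2 / h N p * \<eta> N p"
      using N stress[OF _ p, of N] u_outside(2)[OF p]
      by (simp add: Q_def shear_def power2_norm_eq_inner field_simps)
    have inner_stress: "(\<Sum>\<alpha>=1..N-1. (u (\<alpha> + 1) p - u \<alpha> p) \<bullet> K \<alpha> p)
        = - (\<Sum>\<alpha>=1..N-1. (norm (u (\<alpha> + 1) p - u \<alpha> p))\<^sup>2 / mid_dist h \<alpha> p * \<eta> \<alpha> p)"
      unfolding sum_negf[symmetric]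
    proof (intro sum.cong refl)
      fix \<alpha> assume "\<alpha> \<in> {1..N-1}"
      then have "\<alpha> \<in> {1..N}" "\<alpha> < N"
        by auto
      then show "(u (\<alpha> + 1) p - u \<alpha> p) \<bullet> K \<alpha> p
          = - ((norm (u (\<alpha> + 1) p - u \<alpha> p))\<^sup>2 / mid_dist h \<alpha> p * \<eta> \<alpha> p)"
        using stress[OF _ p, of \<alpha>]
        by (simp add: Q_def shear_def power2_norm_eq_inner divide_inverse mult_ac)
    qed
    have stress_work: "(\<Sum>\<alpha>=1..N. u \<alpha> p \<bullet> (K (\<alpha> - 1) p - K \<alpha> p))
        = - (\<rho> * g * H p * norm (u 1 p) * friction \<mu>\<^sub>s \<mu>\<^sub>2 I\<^sub>0 (Ib p))
          - (norm (u N p))\<^sup>2 / h N p * \<eta> N p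
          - (\<Sum>\<alpha>=1..N-1. (norm (u (\<alpha> + 1) p - u \<alpha> p))\<^sup>2 / mid_dist h \<alpha> p * \<eta> \<alpha> p)"
      unfolding sum_layer_stress[OF N, of "\<lambda>\<alpha>. u \<alpha> p" "\<lambda>\<alpha>. K \<alpha> p"] bottom surface inner_stress
      by simp

    \<comment> \<open>Summation over the layers and conclusion\<close>
    have exchange: "(\<Sum>\<alpha>=1..N. G \<alpha> p * (u (\<alpha> + 1) p \<bullet> u \<alpha> p)
        - G (\<alpha> - 1) p * (u (\<alpha> - 1 + 1) p \<bullet> u (\<alpha> - 1) p)) = 0"
      \<comment> \<open>The two end terms contain \<open>u (N + 1) p\<close> and
        \<open>u 0 p\<close>, the vanishing velocities of the atmosphere and of the bottom.\<close>
      unfolding telescope[of "\<lambda>\<alpha>. G \<alpha> p * (u (\<alpha> + 1) p \<bullet> u \<alpha> p)"]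
      using u_outside[OF p] by simp
    have "(\<Sum>\<alpha>=1..N. dt (k \<alpha>) p + divg (\<lambda>q. k \<alpha> q *\<^sub>R u \<alpha> q) p)
        = (\<Sum>\<alpha>=1..N. u \<alpha> p \<bullet> (K (\<alpha> - 1) p - K \<alpha> p) - m \<alpha> p \<bullet> grad P p
          + \<rho> / 2 * (G \<alpha> p * (u (\<alpha> + 1) p \<bullet> u \<alpha> p)
            - G (\<alpha> - 1) p * (u (\<alpha> - 1 + 1) p \<bullet> u (\<alpha> - 1) p)))"
      by (intro sum.cong refl kinetic)
    also have "\<dots> = (\<Sum>\<alpha>=1..N. u \<alpha> p \<bullet> (K (\<alpha> - 1) p - K \<alpha> p))
        - (\<Sum>\<alpha>=1..N. m \<alpha> p) \<bullet> grad P p"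
      unfolding sum.distrib sum_distrib_left[symmetric] exchange inner_sum_left
        sum_subtractf[of _ "\<lambda>\<alpha>. m \<alpha> p \<bullet> grad P p"] by simp
    finally have kinetic_sum:
      "(\<Sum>\<alpha>=1..N. dt (k \<alpha>) p + divg (\<lambda>q. k \<alpha> q *\<^sub>R u \<alpha> q) p) = \<dots>" .
    have "?L = (\<Sum>\<alpha>=1..N. dt (k \<alpha>) p + divg (\<lambda>q. k \<alpha> q *\<^sub>R u \<alpha> q) p) + (dt V p + divg F p)"
      unfolding dtE divE by (simp add: sum.distrib)
    \<comment> \<open>The work of \<open>grad P p\<close> enters the kinetic and the potential
      balance with opposite signs and cancels: it only converts one form of energy into the
      other.\<close>
    also have "\<dots> = (\<Sum>\<alpha>=1..N. u \<alpha> p \<bullet> (K (\<alpha> - 1) p - K \<alpha> p)) + H p * dt P\<^sub>0 p - Gb p * P p"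
      unfolding kinetic_sum potential by simp
    also have "\<dots> = ?R"
      unfolding stress_work P_def P\<^sub>0_def[abs_def] c_def by (simp add: algebra_simps)
    finally show ?thesis
      by simp
  qed
qed

end
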